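(* Let $H = (\omega, E)$ be the hypergraph whose vertex set is $\omega$ and whose edge set $E$ is the collection of all finite subsets of $\omega$. Then $H$ has no strongly minimal cover.
   Context: Here $\omega = \{0,1,2,\dots\}$ is the set of natural numbers. A hypergraph is a pair $H=(V,E)$ where $V$ is a set and $E \subseteq \mathcal{P}(V)$, with $\mathcal{P}(V)$ the power set of $V$; the elements of $E$ are called edges. An (edge) cover of a hypergraph $H=(V,E)$ is a subset $K \subseteq E$ such that $\bigcup K = V$. A cover $M \subseteq E$ is called strongly minimal if for every cover $K \subseteq E$ we have $\mathrm{card}(M \setminus K) \leq \mathrm{card}(K \setminus M)$, where $\mathrm{card}$ denotes cardinality. *)

theory Defs
  imports Main
begin

unbundle cardinal_syntax

type_synonym 'a hypergraph_pair = "'a set \<times> 'a set set"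

definition hypergraph :: "'a hypergraph_pair \<Rightarrow> bool" where
  "hypergraph H \<longleftrightarrow> snd H \<subseteq> Pow (fst H)"

definition edge_cover :: "'a hypergraph_pair \<Rightarrow> 'a set set \<Rightarrow> bool" where
  "edge_cover H K \<longleftrightarrow> K \<subseteq> snd H \<and> \<Union>K = fst H"

text \<open>Cardinalities are compared as cardinal numbers, via \<open>\<le>o\<close> on \<^const>\<open>card_of\<close>, since the
  differences may be infinite and \<^const>\<open>card\<close> is 0 on infinite sets.\<close>

definition strongly_minimal_cover :: "'a hypergraph_pair \<Rightarrow> 'a set set \<Rightarrow> bool" where
  "strongly_minimal_cover H M \<longleftrightarrow>
     edge_cover H M \<and> (\<forall>K. edge_cover H K \<longrightarrow> |M - K| \<le>o |K - M| )"

definition finite_subsets_hypergraph :: "nat hypergraph_pair" where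
  "finite_subsets_hypergraph = (UNIV, {A. finite A})"

lemma hypergraph_finite_subsets_hypergraph: "hypergraph finite_subsets_hypergraph"
  by (simp add: hypergraph_def finite_subsets_hypergraph_def)

end

theory Submission
  imports Defs
begin

text \<open>Merging two edges of a cover into their union gives a cover again. Two edges are lost and at
  most one is gained, so a strongly minimal cover cannot survive a merge, unless one of the two
  edges contains the other and the merge does nothing but keep the larger one; but then the
  smaller edge is lost for nothing. A merge of two distinct edges is thus always profitable. It is
  available as soon as the union of two edges is an edge and every cover has two edges, and the
  latter holds when the vertex set is nonempty and no single edge is all of it. The finite subsets of an infinite set
  meet these conditions.\<close>

lemma card_le_of_card_of_ordLeq:
  assumes "|A| \<le>o |B|" and "finite B"
  shows "card A \<le> card B"
  using assms card_inj_on_le by (metis card_of_ordLeq)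

text \<open>The vertex set has to be nonempty: over the empty vertex set, the empty family covers and
  is strongly minimal.\<close>

lemma no_strongly_minimal_cover_of_union_closed:
  assumes union_closed: "\<And>a b. a \<in> E \<Longrightarrow> b \<in> E \<Longrightarrow> a \<union> b \<in> E"
    and proper: "V \<notin> E"
    and nonempty: "V \<noteq> {}"
  shows "\<not> strongly_minimal_cover (V, E) M"
proof
  assume "strongly_minimal_cover (V, E) M"
  then have M: "M \<subseteq> E" "\<Union>M = V"
    and minimal: "\<And>K. edge_cover (V, E) K \<Longrightarrow> |M - K| \<le>o |K - M|"
    by (auto simp: strongly_minimal_cover_def edge_cover_def)
  from M nonempty obtain a where a: "a \<in> M" by blast
  with M proper have "a \<noteq> V" by blast
  with M a obtain b where b: "b \<in> M" "\<not> b \<subseteq> a" by blast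
  define K where "K = insert (a \<union> b) (M - {a, b})"
  have "a \<union> b \<in> E" using union_closed M a b by blast
  then have "edge_cover (V, E) K"
    using M a b by (auto simp: K_def edge_cover_def)
  then have "|M - K| \<le>o |K - M|" by (rule minimal)
  moreover have "finite (K - M)"
    by (rule finite_subset[of _ "{a \<union> b}"]) (auto simp: K_def)
  ultimately have le: "card (M - K) \<le> card (K - M)"
    by (rule card_le_of_card_of_ordLeq)
  show False
  proof (cases "a \<union> b \<in> M")
    case True
    \<comment> \<open>Nothing is gained, and \<open>a\<close> is lost because \<open>a \<union> b\<close> is strictly larger. The edge \<open>b\<close> may
      be kept, namely when it contains \<open>a\<close>.\<close>
    then have "K - M = {}" by (auto simp: K_def)
    moreover have "a \<in> M - K" using a b by (auto simp: K_def)
    moreover have "finite (M - K)"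
      by (rule finite_subset[of _ "{a, b}"]) (auto simp: K_def)
    ultimately show False using le by (metis card.empty card_eq_0_iff empty_iff le_zero_eq)
  next
    case False
    then have "K - M = {a \<union> b}" and "M - K = {a, b}" using a b by (auto simp: K_def)
    moreover have "a \<noteq> b" using b by blast
    ultimately show False using le by simp
  qed
qed

theorem lemma2p1:
  "\<not> (\<exists>M. strongly_minimal_cover finite_subsets_hypergraph M)"
  unfolding finite_subsets_hypergraph_def
  using no_strongly_minimal_cover_of_union_closed[of "{A :: nat set. finite A}" UNIV] by simp

end
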